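(* Consider the linearly constrained problem $\min_{x\in X}\{f(x):Ax=b\}$ and the AC-PDHG iteration for it (defined in the context, with $Y=\mathbb{R}^m$, $g(y)=\langle b,y\rangle$, $\widetilde y_0=\mathbf 0$). Suppose the parameters $\eta_t>0$, $\tau_t\ge0$, $\mu_d>0$, $\beta\in(0,1)$ satisfy $$\tau_1=0,\quad\beta_1=0,\quad\beta_t=\beta>0\ (t\ge2),\qquad \eta_2\le\min\Big\{(1-\beta)\eta_1,\frac{\mu_d}{4L_{A,1}^2}\Big\},$$ $$\eta_t\le\min\Big\{2(1-\beta)^2\eta_{t-1},\ \frac{\tau_{t-2}+\mu_d}{\tau_{t-1}}\eta_{t-1},\ \frac{\tau_{t-1}}{4L_{A,t-1}^2}\Big\},\quad t\ge3.$$ Let $\widehat x_k=\frac{\sum_{t=1}^k\eta_{t+1}x_t}{\sum_{t=1}^k\eta_{t+1}}$. Then for every $k\ge2$, $$f(\widehat x_k)-f(x^* )\le\frac1{\sum_{t=1}^k\eta_t}\Big[\frac{\|x_0-x^*\|^2}{2\beta}+\Big(\frac{5\eta_2L_{A,1}^2}{4\mu_d}-\frac{\eta_2}{2\eta_1}\Big)\|x_1-x_0\|^2\Big],$$ $$\|A\widehat x_k-b\|\le2\mu_d\|y^*\|+2\sqrt{\frac{\mu_d}{\sum_{t=1}^k\eta_t}\Big[\frac{\|x_0-x^*\|^2}{2\beta}+\Big(\frac{5\eta_2L_{A,1}^2}{4\mu_d}-\frac{\eta_2}{2\eta_1}\Big)\|x_1-x_0\|^2\Big]}.$$ More specifically,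 suppose the parameters are selected as follows: $\eta_1>0$, $\beta\in(0,1-\frac{\sqrt6}{3}]$, $\beta_1=0$, $\beta_t=\beta$ for $t\ge 2$, $\tau_1=0$, $\tau_2=\mu_d$, $\eta_2=\min\{(1-\beta)\eta_1,\frac{\mu_d}{4L_{A,1}^2}\}$, and for $t\ge3$ $$\eta_t=\min\Big\{\tfrac43\eta_{t-1},\frac{\tau_{t-2}+\mu_d}{\tau_{t-1}}\eta_{t-1},\frac{\tau_{t-1}}{4L_{A,t-1}^2}\Big\},\quad\tau_t=\tau_{t-1}+\frac{\mu_d}{2}\Big[\alpha+(1-\alpha)\eta_t\frac{4L_{A,t-1}^2}{\tau_{t-1}}\Big]$$ with an absolute constant $\alpha\in(0,1]$. Then, with $\widehat L_{A,k}:=\max\{\sqrt{\frac{\mu_d}{4(1-\beta)\eta_1}},L_{A,1},\dots,L_{A,k}\}$, for every $k\ge2$, $$f(\widehat x_k)-f(x^* )\le\frac{12\widehat L_{A,k}^2}{\mu_d(6k+\alpha k(k-3))}\Big[\frac{\|x_0-x^*\|^2}{\beta}+\Big(\frac{5\eta_2L_{A,1}^2}{2\mu_d}-\frac{\eta_2}{2\eta_1}\Big)\|x_1-x_0\|^2\Big],$$ $$\|A\widehat x_k-b\|\le2\mu_d\|y^*\|+2\sqrt{\frac{12\widehat L_{A,k}^2}{6k+\alpha k(k-3)}\Big[\frac{\|x_0-x^*\|^2}{\beta}+\Big(\frac{5\eta_2L_{A,1}^2}{2\mu_d}-\frac{\eta_2}{2\eta_1}\Big)\|x_1-x_0\|^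2\Big]}.$$
   Context: Setting: $X\subseteq\mathbb{R}^n$ is a nonempty closed convex set, $A\in\mathbb{R}^{m\times n}$, $b\in\mathbb{R}^m$, and $f:X\to\mathbb{R}$ is proper, lower semicontinuous and convex. Norms are Euclidean. It is assumed that there are an optimal solution $x^*$ of $\min_{x\in X}\{f(x):Ax=b\}$ and $y^*\in\mathbb{R}^m$ such that $(x^*,y^* )$ is a saddle point of $\min_{x\in X}\max_{y\in\mathbb{R}^m}f(x)+\langle Ax-b,y\rangle$. AC-PDHG iteration (for $Y=\mathbb{R}^m$, $g(y)=\langle b,y\rangle$, $\widetilde y_0=\mathbf 0$): given $x_0=\bar x_0\in X$, $\mu_d>0$ and parameters $\beta_t\in[0,1)$, $\eta_t$, $\tau_t$, set $y_0=\arg\min_{y\in\mathbb{R}^m}\{\langle -Ax_0+b,y\rangle+\frac{\mu_d}{2}\|y\|^2\}$, and for $t=1,2,\dots$ - $x_t=\arg\min_{x\in X}\{\eta_t[\langle A^\top y_{t-1},x\rangle+f(x)]+\frac12\|\bar x_{t-1}-x\|^2\}$, - $\bar x_t=(1-\beta_t)\bar x_{t-1}+\beta_tx_t$, - $y_t=\arg\min_{y\in\mathbb{R}^m}\{\langle -Ax_t+b,y\rangle+\frac{\mu_d}{2}\|y\|^2+\frac{\tau_t}{2}\|y_{t-1}-y\|^2\}$. Local norm estimates: $L_{A,t}=\|A^\top(y_t-y_{t-1})\|/\|y_t-y_{t-1}\|$ for $t\ge1$. Conventions: $0/0=0$ and $a/0=+\infty$ for $a>0$. The parameters $\eta_t,\tau_t$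 may depend on previously computed iterates.
   Formalization: In the first pair of bounds the sum of η_t is replaced by the sum of η_{t+1} (t=1..k), as the printed one fails; the bracket is replaced by its positive part under both square roots (else undefined) and in the second objective bound (else false when the bracket is negative). *)

theory Defs
  imports "HOL-Analysis.Analysis"
begin

text \<open>
  A convex function on \<open>X\<close> is an ordinary real function whose values outside \<open>X\<close> are never used.
  Since \<open>X\<close> is closed, lower semicontinuity relative to \<open>X\<close> is the same as lower semicontinuity
  of the extension by \<open>\<infinity>\<close>; such a function is automatically proper when \<open>X\<close> is nonempty.
\<close>

definition lsc_on :: "'a::topological_space set \<Rightarrow> ('a \<Rightarrow> real) \<Rightarrow> bool" where
  "lsc_on X f \<longleftrightarrow> (\<forall>x\<in>X. \<forall>c<f x. \<forall>\<^sub>F z in at x within X. c < f z)"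

definition lagrangian ::
    "(real^'n \<Rightarrow> real) \<Rightarrow> real^'n^'m \<Rightarrow> real^'m \<Rightarrow> real^'n \<Rightarrow> real^'m \<Rightarrow> real" where
  "lagrangian f A b x y = f x + (A *v x - b) \<bullet> y"

definition saddle_point ::
    "(real^'n) set \<Rightarrow> (real^'n \<Rightarrow> real) \<Rightarrow> real^'n^'m \<Rightarrow> real^'m \<Rightarrow> real^'n \<Rightarrow> real^'m \<Rightarrow> bool" where
  "saddle_point X f A b xs ys \<longleftrightarrow> xs \<in> X \<and>
     (\<forall>y. lagrangian f A b xs y \<le> lagrangian f A b xs ys) \<and>
     (\<forall>x\<in>X. lagrangian f A b xs ys \<le> lagrangian f A b x ys)"

text \<open>
  The sequences \<open>\<beta>\<close>, \<open>\<eta>\<close>, \<open>\<tau>\<close> are arbitrary, hence may depend on the iterates.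
  For \<open>\<eta> t > 0\<close>, \<open>\<tau> t \<ge> 0\<close> and \<open>\<mu> > 0\<close> every objective below is strongly convex, so its
  minimizer is unique and \<^const>\<open>is_arg_min\<close> determines the iterates.
\<close>

definition ac_pdhg ::
    "(real^'n) set \<Rightarrow> (real^'n \<Rightarrow> real) \<Rightarrow> real^'n^'m \<Rightarrow> real^'m \<Rightarrow> real \<Rightarrow>
     (nat \<Rightarrow> real) \<Rightarrow> (nat \<Rightarrow> real) \<Rightarrow> (nat \<Rightarrow> real) \<Rightarrow>
     (nat \<Rightarrow> real^'n) \<Rightarrow> (nat \<Rightarrow> real^'n) \<Rightarrow> (nat \<Rightarrow> real^'m) \<Rightarrow> bool" where
  "ac_pdhg X f A b \<mu> \<beta> \<eta> \<tau> x xbar y \<longleftrightarrow>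
     x 0 \<in> X \<and> xbar 0 = x 0 \<and>
     is_arg_min (\<lambda>v. (b - A *v x 0) \<bullet> v + \<mu> / 2 * (norm v)\<^sup>2) (\<lambda>v. v \<in> UNIV) (y 0) \<and>
     (\<forall>t\<ge>1.
        is_arg_min (\<lambda>u. \<eta> t * ((transpose A *v y (t - 1)) \<bullet> u + f u)
                          + 1 / 2 * (norm (xbar (t - 1) - u))\<^sup>2) (\<lambda>u. u \<in> X) (x t) \<and>
        xbar t = (1 - \<beta> t) *\<^sub>R xbar (t - 1) + \<beta> t *\<^sub>R x t \<and>
        is_arg_min (\<lambda>v. (b - A *v x t) \<bullet> v + \<mu> / 2 * (norm v)\<^sup>2
                          + \<tau> t / 2 * (norm (y (t - 1) - v))\<^sup>2) (\<lambda>v. v \<in> UNIV) (y t))"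

text \<open>
  A vanishing denominator forces a vanishing numerator here, so real division with \<open>0 / 0 = 0\<close>
  is the intended convention.
\<close>

definition local_norm :: "real^'n^'m \<Rightarrow> (nat \<Rightarrow> real^'m) \<Rightarrow> nat \<Rightarrow> real" where
  "local_norm A y t = norm (transpose A *v (y t - y (t - 1))) / norm (y t - y (t - 1))"

definition max_local_norm ::
    "real^'n^'m \<Rightarrow> (nat \<Rightarrow> real^'m) \<Rightarrow> real \<Rightarrow> real \<Rightarrow> real \<Rightarrow> nat \<Rightarrow> real" where
  "max_local_norm A y \<mu> \<beta> \<eta>1 k =
     Max (insert (sqrt (\<mu> / (4 * (1 - \<beta>) * \<eta>1))) (local_norm A y ` {1..k}))"

text \<open>
  Quotient with the conventions \<open>0 / 0 = 0\<close> and \<open>a / 0 = \<infinity>\<close> for \<open>a > 0\<close>; these are exactly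
  the ones of division on \<^typ>\<open>ereal\<close>.
\<close>

definition equot :: "real \<Rightarrow> real \<Rightarrow> ereal" where
  "equot a c = ereal a / ereal c"

lemma equot_zero: "equot 0 0 = 0" "a > 0 \<Longrightarrow> equot a 0 = \<infinity>"
  by (simp_all add: equot_def divide_ereal_def zero_ereal_def[symmetric])

lemma equot_nonzero: "c \<noteq> 0 \<Longrightarrow> equot a c = ereal (a / c)"
  by (simp add: equot_def)

text \<open>
  The weight of \<open>x t\<close> is \<open>\<eta> (t + 1)\<close>.  Bounds for this average must be normalized by
  \<open>\<Sum>t=1..k. \<eta> (t + 1)\<close>: with \<open>\<Sum>t=1..k. \<eta> t\<close>, as printed in the source, they fail when
  \<open>\<eta> 1\<close> is large and all later steps are small.  Bounds whose bracketed constant may be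
  negative are stated with its positive part where the printed form is undefined (below a square
  root) or false.
\<close>

definition ergodic_avg :: "(nat \<Rightarrow> real) \<Rightarrow> (nat \<Rightarrow> real^'n) \<Rightarrow> nat \<Rightarrow> real^'n" where
  "ergodic_avg \<eta> x k =
     (1 / (\<Sum>t=1..k. \<eta> (t + 1))) *\<^sub>R (\<Sum>t=1..k. \<eta> (t + 1) *\<^sub>R x t)"

end

theory Submission
  imports Defs
begin

text \<open>
  The argument is a telescoping energy estimate.  Write \<open>w t = A x t - b\<close>, and let \<open>xs\<close> be the
  optimal solution.

  Adding the optimality condition of the primal step \<open>t + 1\<close> at \<open>xs\<close> to that of step \<open>t\<close> at
  \<open>x (t + 1)\<close> bounds the Lagrangian residual of \<open>x t\<close> with the weight \<open>\<eta> (t + 1)\<close>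
  (\<open>primal_descent\<close>); this is why \<open>x t\<close> enters the average with the step size that follows it.
  The extrapolation \<open>xbar\<close> turns the resulting inner product into a difference of squared
  distances to \<open>xs\<close>, at the price of a negative multiple of
  \<open>r\<^sup>2\<close>, where \<open>r\<close> is the distance between \<open>x (t + 1)\<close> and \<open>xbar t\<close>.  This negative term pays
  for the two remaining ones: the momentum term, whose ratio of step sizes is limited by the growth
  condition, and the coupling of \<open>y t - y (t - 1)\<close> with \<open>x t - x (t + 1)\<close>, where the bound by the
  local norm estimate lets Young's inequality absorb the dual part into the dual proximal term.  A
  quarter of \<open>r\<^sup>2\<close> survives and pays for the next iteration (\<open>later_primal_step\<close>).  In the first
  iteration there is no dual proximal term because \<open>\<tau> 1 = 0\<close>; instead \<open>y 1 - y 0\<close> is an explicit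
  linear image of \<open>x 1 - x 0\<close>, which produces the extra constant (\<open>first_primal_step\<close>).

  The dual step is a quadratic problem, so its optimality condition is an identity
  (\<open>dual_step\<close>), whose weights telescope by the condition linking \<open>\<eta>\<close> and \<open>\<tau>\<close>.  Summation and
  convexity bound the regularized gap
  \<open>f z - f xs + \<langle>A z - b, v\<rangle> - \<mu> |v|\<^sup>2 / 2\<close> at the average \<open>z\<close> for every \<open>v\<close>
  (\<open>ergodic_gap\<close>).  The choice \<open>v = 0\<close> bounds the objective.  The choice \<open>v = (A z - b) / \<mu>\<close>,
  combined with the saddle point inequality for \<open>f z - f xs\<close>, gives a quadratic inequality for the
  norm of \<open>A z - b\<close> (\<open>infeasibility_bound\<close>).

  For the explicit step sizes, \<open>\<tau> t\<close> grows linearly, between \<open>\<mu> (1 + \<alpha> (t - 2) / 2)\<close> and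
  \<open>\<mu> t / 2\<close>.  The upper bound lets \<open>\<eta>\<close> grow by the factor \<open>t / (t - 1)\<close>, and the lower bound makes
  the local restriction compatible with linear growth.  Hence \<open>\<eta> t\<close> is at least
  \<open>\<mu> (1 + \<alpha> (t - 3) / 3) / (4 M\<^sup>2)\<close> as long as \<open>M\<close> dominates the local norms
  and is not too small for the first step (\<open>\<eta>_lower_bound\<close>), and summing this linear function gives the quadratic rate in \<open>k\<close>.
\<close>

section \<open>Proximal steps\<close>

text \<open>
  Comparison of \<open>p\<close> with the point at parameter \<open>e\<close> on the segment to \<open>u\<close>: the quadratic term
  contributes its derivative plus an error of order \<open>e\<close> after division by \<open>e\<close>.
\<close>

lemma prox_variational_inequality:
  fixes \<phi> :: "'a::real_inner \<Rightarrow> real"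
  assumes "convex_on X \<phi>"
    and min: "is_arg_min (\<lambda>u. \<phi> u + 1 / 2 * (norm (z - u))\<^sup>2) (\<lambda>u. u \<in> X) p"
    and u: "u \<in> X"
  shows "\<phi> p - \<phi> u \<le> (z - p) \<bullet> (p - u)"
proof -
  have p: "p \<in> X" and le: "\<And>w. w \<in> X \<Longrightarrow> \<phi> p + 1 / 2 * (norm (z - p))\<^sup>2 \<le> \<phi> w + 1 / 2 * (norm (z - w))\<^sup>2"
    using min by (auto simp: is_arg_min_linorder)
  have conv: "convex X"
    using assms(1) by (rule convex_on_imp_convex)
  define N where "N = (norm (p - u))\<^sup>2 / 2"
  have bound: "\<phi> p - \<phi> u \<le> (z - p) \<bullet> (p - u) + e * N" if e: "0 < e" "e \<le> 1" for e
  proof -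
    define w where "w = (1 - e) *\<^sub>R p + e *\<^sub>R u"
    have "w \<in> X"
      unfolding w_def using conv p u e by (intro convexD) auto
    then have "\<phi> p + 1 / 2 * (norm (z - p))\<^sup>2 \<le> \<phi> w + 1 / 2 * (norm (z - w))\<^sup>2"
      by (rule le)
    moreover have "\<phi> w \<le> (1 - e) * \<phi> p + e * \<phi> u"
      unfolding w_def using convex_onD[OF assms(1), of e p u] e p u by simp
    moreover have "(norm (z - w))\<^sup>2 = (norm (z - p))\<^sup>2 + 2 * e * ((z - p) \<bullet> (p - u)) + e * e * (norm (p - u))\<^sup>2"
      unfolding w_def power2_norm_eq_inner
      by (simp add: inner_simps inner_commute algebra_simps)
    ultimately have "e * (\<phi> p - \<phi> u) \<le> e * ((z - p) \<bullet> (p - u) + e * N)"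
      unfolding N_def by (simp add: algebra_simps)
    then show ?thesis
      using e by simp
  qed
  have "((\<lambda>e. (z - p) \<bullet> (p - u) + e * N) \<longlongrightarrow> (z - p) \<bullet> (p - u) + 0 * N) (at_right 0)"
    by (intro tendsto_intros)
  moreover have "eventually (\<lambda>e. \<phi> p - \<phi> u \<le> (z - p) \<bullet> (p - u) + e * N) (at_right (0::real))"
    unfolding eventually_at_right_field by (rule exI[of _ 1]) (auto intro: bound)
  ultimately show ?thesis
    using tendsto_lowerbound[of _ _ "at_right (0::real)"] by fastforce
qed

text \<open>
  Completing the square: the objective exceeds its value at the stationary point \<open>r\<close> by exactly
  \<open>(m + s) / 2\<close> times the squared distance to \<open>r\<close>.
\<close>

lemma arg_min_regularized_linear:
  fixes c :: "'a::real_inner"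
  assumes pos: "m + s > 0"
    and min: "is_arg_min (\<lambda>v. c \<bullet> v + m / 2 * (norm v)\<^sup>2 + s / 2 * (norm (q - v))\<^sup>2)
      (\<lambda>v. v \<in> UNIV) p"
  shows "m *\<^sub>R p + s *\<^sub>R (p - q) = - c"
proof -
  define r where "r = (1 / (m + s)) *\<^sub>R (s *\<^sub>R q - c)"
  have r: "(m + s) *\<^sub>R r = s *\<^sub>R q - c"
    using pos by (simp add: r_def)
  have c: "c = s *\<^sub>R q - (m + s) *\<^sub>R r"
    by (simp add: r)
  have "c \<bullet> p + m / 2 * (norm p)\<^sup>2 + s / 2 * (norm (q - p))\<^sup>2
      \<le> c \<bullet> r + m / 2 * (norm r)\<^sup>2 + s / 2 * (norm (q - r))\<^sup>2"
    using min by (auto simp: is_arg_min_linorder)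
  moreover have "c \<bullet> p + m / 2 * (norm p)\<^sup>2 + s / 2 * (norm (q - p))\<^sup>2
      = c \<bullet> r + m / 2 * (norm r)\<^sup>2 + s / 2 * (norm (q - r))\<^sup>2 + (m + s) / 2 * (norm (p - r))\<^sup>2"
    unfolding c power2_norm_eq_inner by (simp add: inner_simps inner_commute field_simps)
  ultimately have "(m + s) / 2 * (norm (p - r))\<^sup>2 \<le> 0"
    by linarith
  then have "p = r"
    using pos by (simp add: mult_le_0_iff)
  then show ?thesis
    using r by (simp add: algebra_simps)
qed

text \<open>
  The usual three-point identity would bound the progress by the distance of \<open>p\<close> to \<open>u\<close>; here that
  distance is eliminated in favour of the relaxed point \<open>w\<close>, so that the estimates for consecutive
  relaxed points telescope.  For \<open>\<beta> < 1\<close> the coefficient \<open>2 - \<beta>\<close> exceeds the \<open>1\<close> of the usual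
  identity; this is the gain of the relaxation.
\<close>

lemma three_point_relaxation:
  fixes z p u :: "'a::real_inner"
  assumes "\<beta> > 0" and w: "w = (1 - \<beta>) *\<^sub>R z + \<beta> *\<^sub>R p"
  shows "(z - p) \<bullet> (p - u)
    = ((norm (z - u))\<^sup>2 - (norm (w - u))\<^sup>2) / (2 * \<beta>) - (2 - \<beta>) / 2 * (norm (p - z))\<^sup>2"
proof -
  have "(norm (w - u))\<^sup>2
      = (norm (z - u))\<^sup>2 - 2 * \<beta> * ((z - p) \<bullet> (p - u)) - \<beta> * (2 - \<beta>) * (norm (p - z))\<^sup>2"
    unfolding w power2_norm_eq_inner by (simp add: inner_simps inner_commute algebra_simps)
  then show ?thesis
    using assms(1) by (simp add: field_simps)
qed

lemma inner_le_young:
  fixes p r :: "'a::real_inner"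
  assumes "\<epsilon> > 0"
  shows "p \<bullet> r \<le> \<epsilon> * (norm p)\<^sup>2 + (norm r)\<^sup>2 / (4 * \<epsilon>)"
proof -
  have "0 \<le> (norm ((2 * \<epsilon>) *\<^sub>R p - r))\<^sup>2 / (4 * \<epsilon>)"
    using assms by simp
  also have "\<dots> = \<epsilon> * (norm p)\<^sup>2 + (norm r)\<^sup>2 / (4 * \<epsilon>) - p \<bullet> r"
    unfolding power2_norm_eq_inner using assms by (simp add: inner_simps inner_commute field_simps)
  finally show ?thesis by simp
qed

lemma transpose_inner_eq: "(transpose A *v v) \<bullet> u = v \<bullet> (A *v u)" for A :: "real^'n^'m"
  by (simp add: transpose_matrix_vector dot_lmul_matrix)

lemma norm_transpose_diff:
  "norm (transpose A *v (y t - y (t - 1))) = local_norm A y t * norm (y t - y (t - 1))"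
  by (cases "y t = y (t - 1)") (simp_all add: local_norm_def)

section \<open>Telescoping under admissible step sizes\<close>

text \<open>
  The step size conditions in product form.  The positivity of \<open>\<tau> t\<close> for \<open>t \<ge> 2\<close> is forced by a
  positive \<open>\<eta> (t + 1)\<close> below the extended quotient of \<open>\<tau> t\<close> by the squared local norm, since that
  quotient vanishes with \<open>\<tau> t\<close>.
\<close>

locale ac_pdhg_admissible =
  fixes X :: "(real^'n) set" and f :: "real^'n \<Rightarrow> real"
    and A :: "real^'n^'m" and b :: "real^'m" and xs :: "real^'n"
    and x xbar :: "nat \<Rightarrow> real^'n" and y :: "nat \<Rightarrow> real^'m"
    and \<mu> \<beta> :: real and \<beta>t \<eta> \<tau> :: "nat \<Rightarrow> real"
  assumes convex_f: "convex_on X f"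
    and xs_in: "xs \<in> X" and xs_feasible: "A *v xs = b"
    and \<mu>_pos: "\<mu> > 0"
    and run: "ac_pdhg X f A b \<mu> \<beta>t \<eta> \<tau> x xbar y"
    and \<beta>_pos: "\<beta> > 0" and \<beta>_less: "\<beta> < 1"
    and \<beta>t_1: "\<beta>t 1 = 0" and \<beta>t_eq: "\<And>t. t \<ge> 2 \<Longrightarrow> \<beta>t t = \<beta>"
    and \<eta>_pos: "\<And>t. t \<ge> 1 \<Longrightarrow> \<eta> t > 0"
    and \<tau>_1: "\<tau> 1 = 0" and \<tau>_pos: "\<And>t. t \<ge> 2 \<Longrightarrow> \<tau> t > 0"
    and \<eta>_2: "\<eta> 2 \<le> (1 - \<beta>) * \<eta> 1" "\<eta> 2 * (4 * (local_norm A y 1)\<^sup>2) \<le> \<mu>"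
    and \<eta>_growth: "\<And>t. t \<ge> 2 \<Longrightarrow> \<eta> (Suc t) \<le> 2 * (1 - \<beta>)\<^sup>2 * \<eta> t"
    and \<eta>_dual: "\<And>t. t \<ge> 2 \<Longrightarrow> \<eta> (Suc t) * \<tau> t \<le> \<eta> t * (\<tau> (t - 1) + \<mu>)"
    and \<eta>_local: "\<And>t. t \<ge> 2 \<Longrightarrow> \<eta> (Suc t) * (4 * (local_norm A y t)\<^sup>2) \<le> \<tau> t"
begin

lemma \<tau>_nonneg: "t \<ge> 1 \<Longrightarrow> \<tau> t \<ge> 0"
  using \<tau>_1 \<tau>_pos[of t] by (cases "t = 1") auto

lemma x_in: "x t \<in> X"
  using run by (cases "t \<ge> 1") (auto simp: ac_pdhg_def is_arg_min_def not_less_eq_eq)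

lemma xbar_step: "t \<ge> 1 \<Longrightarrow> xbar t = (1 - \<beta>t t) *\<^sub>R xbar (t - 1) + \<beta>t t *\<^sub>R x t"
  using run by (auto simp: ac_pdhg_def)

lemma xbar_1: "xbar 1 = x 0"
  using xbar_step[of 1] run \<beta>t_1 by (simp add: ac_pdhg_def)

lemma xbar_minus_x: "t \<ge> 2 \<Longrightarrow> xbar t - x t = (1 - \<beta>) *\<^sub>R (xbar (t - 1) - x t)"
  using xbar_step[of t] \<beta>t_eq[of t] by (simp add: algebra_simps)

lemma primal_optimality:
  assumes "t \<ge> 1" "u \<in> X"
  shows "\<eta> t * ((transpose A *v y (t - 1)) \<bullet> (x t - u) + f (x t) - f u)
    \<le> (xbar (t - 1) - x t) \<bullet> (x t - u)"
proof -
  let ?g = "transpose A *v y (t - 1)"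
  have "convex_on X (\<lambda>u. ?g \<bullet> u)"
    by (intro convex_onI convex_on_imp_convex[OF convex_f]) (simp add: inner_simps)
  then have "convex_on X (\<lambda>u. \<eta> t * (?g \<bullet> u + f u))"
    using \<eta>_pos[OF assms(1)] by (intro convex_on_cmul convex_on_add convex_f) auto
  moreover have "is_arg_min (\<lambda>u. \<eta> t * (?g \<bullet> u + f u) + 1 / 2 * (norm (xbar (t - 1) - u))\<^sup>2)
      (\<lambda>u. u \<in> X) (x t)"
    using run assms(1) by (simp add: ac_pdhg_def)
  ultimately have "\<eta> t * (?g \<bullet> x t + f (x t)) - \<eta> t * (?g \<bullet> u + f u)
      \<le> (xbar (t - 1) - x t) \<bullet> (x t - u)"
    using assms(2) by (rule prox_variational_inequality)
  then show ?thesis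
    by (simp add: inner_simps algebra_simps)
qed

lemma dual_optimality:
  assumes "t \<ge> 1"
  shows "\<mu> *\<^sub>R y t + \<tau> t *\<^sub>R (y t - y (t - 1)) = A *v x t - b"
proof -
  have "is_arg_min (\<lambda>v. (b - A *v x t) \<bullet> v + \<mu> / 2 * (norm v)\<^sup>2 + \<tau> t / 2 * (norm (y (t - 1) - v))\<^sup>2)
      (\<lambda>v. v \<in> UNIV) (y t)"
    using run assms by (simp add: ac_pdhg_def)
  from arg_min_regularized_linear[OF _ this] show ?thesis
    using \<mu>_pos \<tau>_nonneg[OF assms] by simp
qed

text \<open>The initial dual problem is the regularized one with weight \<open>0\<close> on the proximal term.\<close>

lemma dual_initial: "\<mu> *\<^sub>R y 0 = A *v x 0 - b"
proof -
  have "is_arg_min (\<lambda>v. (b - A *v x 0) \<bullet> v + \<mu> / 2 * (norm v)\<^sup>2 + 0 / 2 * (norm (0 - v))\<^sup>2)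
      (\<lambda>v. v \<in> UNIV) (y 0)"
    using run by (simp add: ac_pdhg_def)
  from arg_min_regularized_linear[OF _ this] show ?thesis
    using \<mu>_pos by simp
qed

text \<open>
  Step \<open>t + 1\<close> tested at \<open>xs\<close> controls \<open>f (x (t + 1))\<close> with the multiplier \<open>y t\<close>; step \<open>t\<close> tested
  at \<open>x (t + 1)\<close> transfers this to \<open>f (x t)\<close>, for which \<open>y t\<close> is the multiplier computed from
  \<open>x t\<close> itself.  The two errors of the transfer are the change of multiplier and the momentum term.
\<close>

lemma primal_descent:
  assumes "t \<ge> 1"
  shows "\<eta> (Suc t) * (f (x t) - f xs + (A *v x t - b) \<bullet> y t)
    \<le> ((norm (xbar t - xs))\<^sup>2 - (norm (xbar (Suc t) - xs))\<^sup>2) / (2 * \<beta>)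
      - (2 - \<beta>) / 2 * (norm (x (Suc t) - xbar t))\<^sup>2
      + \<eta> (Suc t) * ((transpose A *v (y t - y (t - 1))) \<bullet> (x t - x (Suc t)))
      + \<eta> (Suc t) / \<eta> t * ((xbar (t - 1) - x t) \<bullet> (x t - x (Suc t)))"
proof -
  let ?g = "transpose A *v y t" and ?g' = "transpose A *v y (t - 1)"
  have "\<eta> (Suc t) * (?g \<bullet> (x (Suc t) - xs) + f (x (Suc t)) - f xs)
      \<le> (xbar t - x (Suc t)) \<bullet> (x (Suc t) - xs)"
    using primal_optimality[of "Suc t" xs] xs_in by simp
  moreover have "\<eta> (Suc t) * (?g' \<bullet> (x t - x (Suc t)) + f (x t) - f (x (Suc t)))
      \<le> \<eta> (Suc t) / \<eta> t * ((xbar (t - 1) - x t) \<bullet> (x t - x (Suc t)))"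
  proof -
    have "?g' \<bullet> (x t - x (Suc t)) + f (x t) - f (x (Suc t))
        \<le> (xbar (t - 1) - x t) \<bullet> (x t - x (Suc t)) / \<eta> t"
      using primal_optimality[OF assms x_in] \<eta>_pos[OF assms]
      by (simp add: pos_le_divide_eq mult.commute)
    then have "\<eta> (Suc t) * (?g' \<bullet> (x t - x (Suc t)) + f (x t) - f (x (Suc t)))
        \<le> \<eta> (Suc t) * ((xbar (t - 1) - x t) \<bullet> (x t - x (Suc t)) / \<eta> t)"
      using \<eta>_pos[of "Suc t"] by (intro mult_left_mono) auto
    then show ?thesis by simp
  qed
  moreover have "(xbar t - x (Suc t)) \<bullet> (x (Suc t) - xs)
      = ((norm (xbar t - xs))\<^sup>2 - (norm (xbar (Suc t) - xs))\<^sup>2) / (2 * \<beta>)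
        - (2 - \<beta>) / 2 * (norm (x (Suc t) - xbar t))\<^sup>2"
    using xbar_step[of "Suc t"] \<beta>t_eq[of "Suc t"] assms
    by (intro three_point_relaxation \<beta>_pos) simp
  moreover have "\<eta> (Suc t) * (f (x t) - f xs + (A *v x t - b) \<bullet> y t)
      = \<eta> (Suc t) * (?g \<bullet> (x (Suc t) - xs) + f (x (Suc t)) - f xs)
        + \<eta> (Suc t) * (?g' \<bullet> (x t - x (Suc t)) + f (x t) - f (x (Suc t)))
        + \<eta> (Suc t) * ((transpose A *v (y t - y (t - 1))) \<bullet> (x t - x (Suc t)))"
  proof -
    have "(A *v x t - b) \<bullet> y t = ?g \<bullet> (x (Suc t) - xs) + ?g' \<bullet> (x t - x (Suc t))
        + (transpose A *v (y t - y (t - 1))) \<bullet> (x t - x (Suc t))"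
      unfolding transpose_inner_eq xs_feasible[symmetric]
      by (simp add: matrix_vector_mult_diff_distrib inner_simps inner_commute)
    then show ?thesis
      by (simp only:) (simp add: algebra_simps)
  qed
  ultimately show ?thesis
    by linarith
qed

text \<open>
  Since \<open>\<tau> 1 = 0\<close>, \<open>\<mu> (y 1 - y 0) = A (x 1 - x 0)\<close>.  Testing this against \<open>y 1 - y 0\<close> bounds
  \<open>\<mu> |y 1 - y 0|\<close> by the local norm times \<open>|x 1 - x 0|\<close>, without the operator norm of \<open>A\<close>.
\<close>

lemma first_primal_step:
  "\<eta> 2 * (f (x 1) - f xs + (A *v x 1 - b) \<bullet> y 1)
    \<le> ((norm (x 0 - xs))\<^sup>2 - (norm (xbar 2 - xs))\<^sup>2) / (2 * \<beta>)
      + (5 * \<eta> 2 * (local_norm A y 1)\<^sup>2 / (4 * \<mu>) - \<eta> 2 / (2 * \<eta> 1)) * (norm (x 1 - x 0))\<^sup>2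
      - 1 / 4 * (norm (x 2 - xbar 1))\<^sup>2"
proof -
  define L where "L = local_norm A y 1"
  define d where "d = y 1 - y 0"
  define p where "p = x 0 - x 1"
  define r where "r = x 0 - x 2"
  define s where "s = \<eta> 2 * L\<^sup>2 / \<mu>"
  define c where "c = \<eta> 2 / \<eta> 1"
  have L0: "L \<ge> 0"
    by (simp add: L_def local_norm_def)
  have eta: "\<eta> 1 > 0" "\<eta> 2 > 0"
    using \<eta>_pos by auto
  have s: "0 \<le> s" "s \<le> 1 / 4"
    using \<eta>_2(2) \<mu>_pos eta by (simp_all add: s_def L_def field_simps)
  have c: "0 \<le> c" "c \<le> 1 - \<beta>"
    using \<eta>_2(1) eta by (simp_all add: c_def field_simps)
  have nd: "norm (transpose A *v d) = L * norm d"
    using norm_transpose_diff[of A y 1] by (simp add: L_def d_def)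
  have "\<mu> *\<^sub>R d = A *v (x 1 - x 0)"
    using dual_optimality[of 1] dual_initial \<tau>_1
    by (simp add: d_def scaleR_diff_right matrix_vector_mult_diff_distrib)
  then have "\<mu> * (norm d)\<^sup>2 = d \<bullet> (A *v (x 1 - x 0))"
    by (metis inner_scaleR_right power2_norm_eq_inner)
  also have "\<dots> = (transpose A *v d) \<bullet> (x 1 - x 0)"
    by (rule transpose_inner_eq[symmetric])
  also have "\<dots> \<le> norm (transpose A *v d) * norm (x 1 - x 0)"
    by (rule norm_cauchy_schwarz)
  also have "\<dots> = norm d * (L * norm p)"
    unfolding nd by (simp add: p_def norm_minus_commute)
  finally have "norm d * (\<mu> * norm d) \<le> norm d * (L * norm p)"
    by (simp add: power2_eq_square mult_ac)
  then have "\<mu> * norm d \<le> L * norm p"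
    using L0 by (cases "d = 0") simp_all
  then have "norm d \<le> L * norm p / \<mu>"
    using \<mu>_pos by (simp add: field_simps)
  then have "L * norm d \<le> L * (L * norm p / \<mu>)"
    using L0 by (intro mult_left_mono)
  then have d_le: "norm (transpose A *v d) \<le> L\<^sup>2 / \<mu> * norm p"
    unfolding nd by (simp add: power2_eq_square mult.assoc)
  have "\<eta> 2 * ((transpose A *v d) \<bullet> (x 1 - x 2)) \<le> \<eta> 2 * (norm (transpose A *v d) * norm (x 1 - x 2))"
    using eta by (intro mult_left_mono norm_cauchy_schwarz) auto
  also have "\<dots> \<le> \<eta> 2 * (L\<^sup>2 / \<mu> * norm p * (norm p + norm r))"
  proof (intro mult_left_mono mult_mono d_le)
    have "x 1 - x 2 = r - p"
      by (simp add: p_def r_def)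
    then show "norm (x 1 - x 2) \<le> norm p + norm r"
      using norm_triangle_ineq4[of r p] by simp
  qed (use eta \<mu>_pos in auto)
  also have "\<dots> = s * ((norm p)\<^sup>2 + norm p * norm r)"
    by (simp add: s_def power2_eq_square algebra_simps add_divide_distrib)
  also have "\<dots> \<le> s * ((norm p)\<^sup>2 + ((norm p)\<^sup>2 / 4 + (norm r)\<^sup>2))"
    using s(1) inner_le_young[of "1/4" "norm p" "norm r"] by (intro mult_left_mono add_left_mono) auto
  also have "\<dots> \<le> 5 / 4 * s * (norm p)\<^sup>2 + 1 / 4 * (norm r)\<^sup>2"
    using mult_right_mono[OF s(2), of "(norm r)\<^sup>2"] by (simp add: algebra_simps)
  finally have coupling: "\<eta> 2 * ((transpose A *v d) \<bullet> (x 1 - x 2))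
      \<le> 5 / 4 * s * (norm p)\<^sup>2 + 1 / 4 * (norm r)\<^sup>2" .
  \<comment> \<open>Only half of \<open>- c |p|\<^sup>2\<close> is spent, so that the other half stays in the constant.\<close>
  have "p \<bullet> (x 1 - x 2) = p \<bullet> r - (norm p)\<^sup>2"
    by (simp add: p_def r_def power2_norm_eq_inner inner_simps)
  also have "\<dots> \<le> - (norm p)\<^sup>2 / 2 + (norm r)\<^sup>2 / 2"
    using inner_le_young[of "1/2" p r] by simp
  finally have "c * (p \<bullet> (x 1 - x 2)) \<le> c * (- (norm p)\<^sup>2 / 2 + (norm r)\<^sup>2 / 2)"
    using c by (intro mult_left_mono) auto
  also have "\<dots> \<le> - c / 2 * (norm p)\<^sup>2 + (1 - \<beta>) / 2 * (norm r)\<^sup>2"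
    using mult_right_mono[OF c(2), of "(norm r)\<^sup>2"] by (simp add: algebra_simps)
  finally have momentum: "c * (p \<bullet> (x 1 - x 2)) \<le> - c / 2 * (norm p)\<^sup>2 + (1 - \<beta>) / 2 * (norm r)\<^sup>2" .
  have norms: "norm (x 2 - xbar 1) = norm r" "norm (x 1 - x 0) = norm p"
    unfolding r_def p_def xbar_1 by (rule norm_minus_commute)+
  have "xbar 0 = x 0"
    using run by (simp add: ac_pdhg_def)
  then have "\<eta> 2 * (f (x 1) - f xs + (A *v x 1 - b) \<bullet> y 1)
      \<le> ((norm (x 0 - xs))\<^sup>2 - (norm (xbar 2 - xs))\<^sup>2) / (2 * \<beta>) - (2 - \<beta>) / 2 * (norm r)\<^sup>2
        + \<eta> 2 * ((transpose A *v d) \<bullet> (x 1 - x 2)) + c * (p \<bullet> (x 1 - x 2))"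
    using primal_descent[of 1, OF order_refl]
    by (simp only: Suc_1 diff_self_eq_0 norms(1)[symmetric] xbar_1 d_def c_def p_def)
  moreover have "5 * \<eta> 2 * L\<^sup>2 / (4 * \<mu>) - \<eta> 2 / (2 * \<eta> 1) = 5 / 4 * s - c / 2"
    by (simp add: s_def c_def)
  ultimately show ?thesis
    using coupling momentum unfolding norms L_def[symmetric]
    by (simp only:) argo
qed

text \<open>
  With \<open>r = xbar t - x (t + 1)\<close> and \<open>p = xbar t - x t\<close>, the relaxation leaves
  \<open>- (2 - \<beta>) / 2\<close> times \<open>|r|\<^sup>2\<close>.  Momentum costs \<open>(1 - \<beta>) / 2\<close> and coupling \<open>1 / 4\<close> of \<open>|r|\<^sup>2\<close>, so
  exactly one quarter remains; coupling also costs one quarter of \<open>|p|\<^sup>2\<close>, which the quarter left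
  over by the previous iteration covers because the relaxation contracts \<open>xbar (t - 1) - x t\<close>.
\<close>

lemma later_primal_step:
  assumes t: "t \<ge> 2"
  shows "\<eta> (Suc t) * (f (x t) - f xs + (A *v x t - b) \<bullet> y t)
    \<le> ((norm (xbar t - xs))\<^sup>2 - (norm (xbar (Suc t) - xs))\<^sup>2) / (2 * \<beta>)
      + 1 / 4 * (norm (x t - xbar (t - 1)))\<^sup>2 - 1 / 4 * (norm (x (Suc t) - xbar t))\<^sup>2
      + \<eta> (Suc t) * \<tau> t / 2 * (norm (y t - y (t - 1)))\<^sup>2"
proof -
  define L where "L = local_norm A y t"
  define d where "d = y t - y (t - 1)"
  define p where "p = xbar t - x t"
  define r where "r = xbar t - x (Suc t)"
  define q where "q = x t - x (Suc t)"
  define c where "c = \<eta> (Suc t) / \<eta> t / (1 - \<beta>)"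
  have q: "q = r - p"
    by (simp add: p_def r_def q_def)
  have eta: "\<eta> t > 0" "\<eta> (Suc t) > 0" and tau: "\<tau> t > 0"
    using \<eta>_pos \<tau>_pos t by auto
  have c: "0 \<le> c" "c \<le> 2 * (1 - \<beta>)"
    using \<eta>_growth[OF t] eta \<beta>_less by (simp_all add: c_def field_simps power2_eq_square)
  have "(transpose A *v d) \<bullet> q \<le> (norm (transpose A *v d)) * norm q"
    by (rule norm_cauchy_schwarz)
  also have "\<dots> = norm d * (L * norm q)"
    using norm_transpose_diff[of A y t] by (simp add: L_def d_def)
  also have "\<dots> \<le> \<tau> t / 2 * (norm d)\<^sup>2 + (L * norm q)\<^sup>2 / (2 * \<tau> t)"
    using inner_le_young[of "\<tau> t / 2" "norm d" "L * norm q"] tau by simp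
  finally have "\<eta> (Suc t) * ((transpose A *v d) \<bullet> q)
      \<le> \<eta> (Suc t) * (\<tau> t / 2 * (norm d)\<^sup>2 + (L * norm q)\<^sup>2 / (2 * \<tau> t))"
    using eta by (intro mult_left_mono) auto
  also have "\<dots> = \<eta> (Suc t) * \<tau> t / 2 * (norm d)\<^sup>2 + \<eta> (Suc t) * L\<^sup>2 / (2 * \<tau> t) * (norm q)\<^sup>2"
    by (simp add: algebra_simps power_mult_distrib)
  finally have "\<eta> (Suc t) * ((transpose A *v d) \<bullet> q)
      \<le> \<eta> (Suc t) * \<tau> t / 2 * (norm d)\<^sup>2 + \<eta> (Suc t) * L\<^sup>2 / (2 * \<tau> t) * (norm q)\<^sup>2" .
  moreover have "\<eta> (Suc t) * L\<^sup>2 / (2 * \<tau> t) * (norm q)\<^sup>2 \<le> 1 / 8 * (norm q)\<^sup>2"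
    using \<eta>_local[OF t] tau by (intro mult_right_mono) (simp_all add: L_def field_simps)
  moreover have "(norm q)\<^sup>2 \<le> 2 * (norm r)\<^sup>2 + 2 * (norm p)\<^sup>2"
    using zero_le_power2[of "norm (r + p)"]
    by (simp add: q power2_norm_eq_inner inner_simps inner_commute)
  ultimately have coupling: "\<eta> (Suc t) * ((transpose A *v d) \<bullet> q)
      \<le> \<eta> (Suc t) * \<tau> t / 2 * (norm d)\<^sup>2 + 1 / 4 * (norm r)\<^sup>2 + 1 / 4 * (norm p)\<^sup>2"
    by linarith
  \<comment> \<open>Rescaling from \<open>xbar (t - 1)\<close> to \<open>xbar t\<close> divides the step size ratio by \<open>1 - \<beta>\<close>; the growth
    condition, with its square of \<open>1 - \<beta>\<close>, still leaves \<open>c \<le> 2 (1 - \<beta>)\<close>.\<close>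
  have p_xbar: "p = (1 - \<beta>) *\<^sub>R (xbar (t - 1) - x t)"
    using xbar_minus_x[OF t] by (simp add: p_def)
  have "\<eta> (Suc t) / \<eta> t * ((xbar (t - 1) - x t) \<bullet> q) = c * (p \<bullet> q)"
    using \<beta>_less by (simp add: p_xbar c_def)
  also have "p \<bullet> q = p \<bullet> r - (norm p)\<^sup>2"
    by (simp add: q power2_norm_eq_inner inner_simps)
  also have "c * \<dots> \<le> c * ((norm r)\<^sup>2 / 4)"
    using inner_le_young[of 1 p r] c by (intro mult_left_mono) auto
  also have "\<dots> \<le> (1 - \<beta>) / 2 * (norm r)\<^sup>2"
    using mult_right_mono[OF c(2), of "(norm r)\<^sup>2"] by (simp add: algebra_simps)
  finally have momentum: "\<eta> (Suc t) / \<eta> t * ((xbar (t - 1) - x t) \<bullet> q) \<le> (1 - \<beta>) / 2 * (norm r)\<^sup>2" .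
  have "norm p \<le> norm (x t - xbar (t - 1))"
    using \<beta>_pos \<beta>_less mult_right_mono[of "1 - \<beta>" 1 "norm (xbar (t - 1) - x t)"]
    by (simp add: p_xbar norm_minus_commute)
  then have "(norm p)\<^sup>2 \<le> (norm (x t - xbar (t - 1)))\<^sup>2"
    by (intro power_mono) auto
  moreover have "norm (x (Suc t) - xbar t) = norm r"
    by (simp add: r_def norm_minus_commute)
  ultimately show ?thesis
    using primal_descent[of t, folded d_def q_def] coupling momentum t
    unfolding d_def[symmetric] by (simp only: left_diff_distrib diff_divide_distrib) linarith
qed

lemma dual_step:
  assumes "t \<ge> 1"
  shows "(A *v x t - b) \<bullet> v - \<mu> / 2 * (norm v)\<^sup>2
    \<le> (A *v x t - b) \<bullet> y t - \<tau> t / 2 * (norm (y t - y (t - 1)))\<^sup>2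
      + \<tau> t / 2 * (norm (v - y (t - 1)))\<^sup>2 - (\<tau> t + \<mu>) / 2 * (norm (v - y t))\<^sup>2"
proof -
  have "(A *v x t - b) \<bullet> v - \<mu> / 2 * (norm v)\<^sup>2 + \<mu> / 2 * (norm (y t))\<^sup>2
    = (A *v x t - b) \<bullet> y t - \<tau> t / 2 * (norm (y t - y (t - 1)))\<^sup>2
      + \<tau> t / 2 * (norm (v - y (t - 1)))\<^sup>2 - (\<tau> t + \<mu>) / 2 * (norm (v - y t))\<^sup>2"
    unfolding dual_optimality[OF assms, symmetric]  power2_norm_eq_inner
    by (simp add: inner_simps inner_commute field_simps)
  then show ?thesis
    using \<mu>_pos by (smt (verit) divide_pos_pos mult_nonneg_nonneg zero_le_power2)
qed

text \<open>The second summand is the cost of the first primal step; it may be negative.\<close>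

definition error_const :: real where
  "error_const = (norm (x 0 - xs))\<^sup>2 / (2 * \<beta>)
    + (5 * \<eta> 2 * (local_norm A y 1)\<^sup>2 / (4 * \<mu>) - \<eta> 2 / (2 * \<eta> 1)) * (norm (x 1 - x 0))\<^sup>2"

lemma telescoped_gap:
  assumes "k \<ge> 1"
  shows "(\<Sum>t=1..k. \<eta> (t + 1) * (f (x t) - f xs + (A *v x t - b) \<bullet> v - \<mu> / 2 * (norm v)\<^sup>2))
      + (norm (xbar (Suc k) - xs))\<^sup>2 / (2 * \<beta>) + 1 / 4 * (norm (x (Suc k) - xbar k))\<^sup>2
      + \<eta> (Suc k) * (\<tau> k + \<mu>) / 2 * (norm (v - y k))\<^sup>2 \<le> error_const"
  using assms
proof (induction k rule: nat_induct_at_least)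
  case base
  have "\<eta> 2 * (f (x 1) - f xs + ((A *v x 1 - b) \<bullet> v - \<mu> / 2 * (norm v)\<^sup>2))
      \<le> \<eta> 2 * (f (x 1) - f xs + ((A *v x 1 - b) \<bullet> y 1 - \<mu> / 2 * (norm (v - y 1))\<^sup>2))"
    using dual_step[of 1 v] \<tau>_1 \<eta>_pos[of 2] by (intro mult_left_mono add_left_mono) auto
  also have "\<dots> = \<eta> 2 * (f (x 1) - f xs + (A *v x 1 - b) \<bullet> y 1)
      - \<eta> 2 * \<mu> / 2 * (norm (v - y 1))\<^sup>2"
    by (simp add: algebra_simps)
  also note first_primal_step
  finally show ?case
    using \<tau>_1 by (simp add: numeral_2_eq_2[symmetric] error_const_def add_diff_eq diff_divide_distrib)
next
  case (Suc k)
  let ?e = "\<eta> (Suc (Suc k))" and ?t = "Suc k"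
  have "?e * (f (x ?t) - f xs + ((A *v x ?t - b) \<bullet> v - \<mu> / 2 * (norm v)\<^sup>2))
      \<le> ?e * (f (x ?t) - f xs + ((A *v x ?t - b) \<bullet> y ?t - \<tau> ?t / 2 * (norm (y ?t - y k))\<^sup>2
        + \<tau> ?t / 2 * (norm (v - y k))\<^sup>2 - (\<tau> ?t + \<mu>) / 2 * (norm (v - y ?t))\<^sup>2))"
    using dual_step[of ?t v] \<eta>_pos[of "Suc ?t"] by (intro mult_left_mono add_left_mono) auto
  also have "\<dots> = ?e * (f (x ?t) - f xs + (A *v x ?t - b) \<bullet> y ?t)
      - ?e * \<tau> ?t / 2 * (norm (y ?t - y k))\<^sup>2
      + ?e * \<tau> ?t / 2 * (norm (v - y k))\<^sup>2 - ?e * (\<tau> ?t + \<mu>) / 2 * (norm (v - y ?t))\<^sup>2"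
    by (simp add: algebra_simps add_divide_distrib)
  finally have "?e * (f (x ?t) - f xs + (A *v x ?t - b) \<bullet> v - \<mu> / 2 * (norm v)\<^sup>2)
      \<le> ((norm (xbar ?t - xs))\<^sup>2 - (norm (xbar (Suc ?t) - xs))\<^sup>2) / (2 * \<beta>)
      + 1 / 4 * (norm (x ?t - xbar k))\<^sup>2 - 1 / 4 * (norm (x (Suc ?t) - xbar ?t))\<^sup>2
      + ?e * \<tau> ?t / 2 * (norm (v - y k))\<^sup>2 - ?e * (\<tau> ?t + \<mu>) / 2 * (norm (v - y ?t))\<^sup>2"
    using later_primal_step[of ?t] Suc.hyps by (simp add: add_diff_eq)
  moreover have "?e * \<tau> ?t / 2 * (norm (v - y k))\<^sup>2 \<le> \<eta> ?t * (\<tau> k + \<mu>) / 2 * (norm (v - y k))\<^sup>2"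
    using \<eta>_dual[of ?t] Suc.hyps by (intro mult_right_mono divide_right_mono) auto
  moreover have "(\<Sum>t=1..?t. \<eta> (t + 1) * (f (x t) - f xs + (A *v x t - b) \<bullet> v - \<mu> / 2 * (norm v)\<^sup>2))
      = (\<Sum>t=1..k. \<eta> (t + 1) * (f (x t) - f xs + (A *v x t - b) \<bullet> v - \<mu> / 2 * (norm v)\<^sup>2))
        + ?e * (f (x ?t) - f xs + (A *v x ?t - b) \<bullet> v - \<mu> / 2 * (norm v)\<^sup>2)"
    by simp
  ultimately show ?case
    using Suc.IH by (simp only: diff_divide_distrib)
qed

lemma weight_sum_pos: "k \<ge> 1 \<Longrightarrow> (\<Sum>t=1..k. \<eta> (t + 1)) > 0"
  using \<eta>_pos by (intro sum_pos) auto

text \<open>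
  The regularized gap is convex in the primal argument, hence at the average it is at most the
  average of its values; the remaining energy at time \<open>k\<close> is nonnegative.
\<close>

lemma ergodic_gap:
  assumes k: "k \<ge> 1"
  shows "f (ergodic_avg \<eta> x k) - f xs + (A *v ergodic_avg \<eta> x k - b) \<bullet> v - \<mu> / 2 * (norm v)\<^sup>2
    \<le> error_const / (\<Sum>t=1..k. \<eta> (t + 1))"
proof -
  define S where "S = (\<Sum>t=1..k. \<eta> (t + 1))"
  define a where "a t = \<eta> (t + 1) / S" for t
  define R where "R u = f u - f xs + (A *v u - b) \<bullet> v - \<mu> / 2 * (norm v)\<^sup>2" for u
  have S: "S > 0"
    using weight_sum_pos[OF k] by (simp add: S_def)
  have a1: "(\<Sum>t=1..k. a t) = 1"
    using S by (simp add: a_def S_def flip: sum_divide_distrib)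
  have avg: "ergodic_avg \<eta> x k = (\<Sum>t=1..k. a t *\<^sub>R x t)"
    by (simp add: ergodic_avg_def a_def S_def scaleR_sum_right)
  have "convex_on X (\<lambda>u. (A *v u - b) \<bullet> v - K)" for K
    by (intro convex_onI convex_on_imp_convex[OF convex_f])
      (simp add: matrix_vector_right_distrib matrix_vector_mult_scaleR inner_simps algebra_simps)
  from convex_on_add[OF convex_f this[of "f xs + \<mu> / 2 * (norm v)\<^sup>2"]] have "convex_on X R"
    by (simp add: R_def[abs_def] algebra_simps)
  then have "R (ergodic_avg \<eta> x k) \<le> (\<Sum>t=1..k. a t * R (x t))"
    unfolding avg using k a1 x_in \<eta>_pos S by (intro convex_on_sum) (auto simp: a_def intro: less_imp_le)
  also have "\<dots> = (\<Sum>t=1..k. \<eta> (t + 1) * R (x t)) / S"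
    by (simp add: a_def sum_divide_distrib)
  also have "\<dots> \<le> error_const / S"
  proof (intro divide_right_mono)
    have "0 \<le> (norm (xbar (Suc k) - xs))\<^sup>2 / (2 * \<beta>)"
      using \<beta>_pos by simp
    moreover have "0 \<le> \<eta> (Suc k) * (\<tau> k + \<mu>) / 2 * (norm (v - y k))\<^sup>2"
      using \<eta>_pos[of "Suc k"] \<tau>_nonneg[OF k] \<mu>_pos by simp
    moreover have "0 \<le> 1 / 4 * (norm (x (Suc k) - xbar k))\<^sup>2"
      by simp
    ultimately show "(\<Sum>t=1..k. \<eta> (t + 1) * R (x t)) \<le> error_const"
      using telescoped_gap[OF k, of v] unfolding R_def by linarith
  qed (use S in simp)
  finally show ?thesis
    by (simp add: R_def S_def)
qed

lemma objective_bound: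
  assumes "k \<ge> 1"
  shows "f (ergodic_avg \<eta> x k) - f xs \<le> error_const / (\<Sum>t=1..k. \<eta> (t + 1))"
  using ergodic_gap[OF assms, of 0] by simp

lemma ergodic_avg_in:
  assumes "k \<ge> 1"
  shows "ergodic_avg \<eta> x k \<in> X"
proof -
  have "(\<Sum>t=1..k. (\<eta> (t + 1) / (\<Sum>t=1..k. \<eta> (t + 1))) *\<^sub>R x t) \<in> X"
    using weight_sum_pos[OF assms] \<eta>_pos x_in
    by (intro convex_sum convex_on_imp_convex[OF convex_f])
      (auto simp flip: sum_divide_distrib intro!: divide_nonneg_pos less_imp_le)
  then show ?thesis
    by (simp add: ergodic_avg_def scaleR_sum_right)
qed

text \<open>
  The multiplier \<open>w / \<mu>\<close> maximizes \<open>\<langle>w, v\<rangle> - \<mu> |v|\<^sup>2 / 2\<close>, with value \<open>|w|\<^sup>2 / (2 \<mu>)\<close>, while the saddle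
  point keeps the objective from dropping by more than \<open>|w| |ys|\<close>.  The bound follows by solving
  the quadratic inequality for \<open>|w|\<close>.
\<close>

lemma infeasibility_bound:
  assumes k: "k \<ge> 1" and saddle: "saddle_point X f A b xs ys"
    and e: "error_const / (\<Sum>t=1..k. \<eta> (t + 1)) \<le> e" "0 \<le> e"
  shows "norm (A *v ergodic_avg \<eta> x k - b) \<le> 2 * \<mu> * norm ys + sqrt (2 * \<mu> * e)"
proof -
  define w where "w = A *v ergodic_avg \<eta> x k - b"
  have "f xs \<le> f (ergodic_avg \<eta> x k) + w \<bullet> ys"
    using saddle ergodic_avg_in[OF k] xs_feasible
    by (auto simp: saddle_point_def lagrangian_def w_def)
  moreover have "w \<bullet> ys \<le> norm w * norm ys"
    by (rule norm_cauchy_schwarz)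
  moreover have "f (ergodic_avg \<eta> x k) - f xs + (norm w)\<^sup>2 / (2 * \<mu>) \<le> e"
  proof -
    have "w \<bullet> ((1 / \<mu>) *\<^sub>R w) - \<mu> / 2 * (norm ((1 / \<mu>) *\<^sub>R w))\<^sup>2 = (norm w)\<^sup>2 / (2 * \<mu>)"
      using \<mu>_pos by (simp add: power2_norm_eq_inner[symmetric] power_divide)
        (simp add: field_simps power2_eq_square)
    then show ?thesis
      using ergodic_gap[OF k, of "(1 / \<mu>) *\<^sub>R w"] e(1) unfolding w_def by linarith
  qed
  ultimately have "(norm w)\<^sup>2 / (2 * \<mu>) \<le> norm w * norm ys + e"
    by linarith
  then have quad: "(norm w)\<^sup>2 \<le> 2 * \<mu> * norm ys * norm w + 2 * \<mu> * e"
    using \<mu>_pos by (simp add: field_simps)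
  define m where "m = \<mu> * norm ys"
  define s where "s = sqrt (2 * \<mu> * e)"
  have ms: "m \<ge> 0" "s \<ge> 0" "s\<^sup>2 = 2 * \<mu> * e"
    using \<mu>_pos e(2) by (simp_all add: m_def s_def)
  have "(norm w - m)\<^sup>2 \<le> m\<^sup>2 + s\<^sup>2"
    using quad ms by (simp add: m_def power2_diff mult_ac)
  also have "\<dots> \<le> (m + s)\<^sup>2"
    using ms by (simp add: power2_sum)
  finally have "norm w - m \<le> m + s"
    by (rule power2_le_imp_le) (use ms in auto)
  then show ?thesis
    by (simp add: w_def m_def s_def)
qed

end

section \<open>Step sizes\<close>

text \<open>
  The inequality between reals does not see the case \<open>a = c = 0\<close>, where the quotient is \<open>0\<close> and no
  positive \<open>e\<close> lies below it; the conjunct \<open>a > 0\<close> excludes it.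
\<close>

lemma le_equot_iff:
  assumes "e > 0" "c \<ge> 0" "a \<ge> 0"
  shows "ereal e \<le> equot a c \<longleftrightarrow> a > 0 \<and> e * c \<le> a"
proof (cases "c = 0")
  case True
  then show ?thesis
    using assms equot_zero by (cases "a = 0") (auto simp: zero_ereal_def)
next
  case False
  moreover have "e * c > 0"
    using False assms by simp
  ultimately show ?thesis
    using assms by (auto simp: equot_nonzero pos_le_divide_eq simp del: mult_pos_pos)
qed

lemma equot_pos: "a > 0 \<Longrightarrow> c \<ge> 0 \<Longrightarrow> equot a c > 0"
  by (cases "c = 0") (simp_all add: equot_nonzero equot_zero zero_ereal_def)

text \<open>
  The explicit rule depends on the iterates only through their local norm estimates \<open>L t\<close>, and its
  growth can be studied for an arbitrary nonnegative sequence \<open>L\<close>.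
\<close>

locale adaptive_steps =
  fixes L \<eta> \<tau> :: "nat \<Rightarrow> real" and \<mu> \<beta> \<alpha> :: real
  assumes \<mu>_pos: "\<mu> > 0" and \<beta>_less: "\<beta> < 1" and \<alpha>: "0 < \<alpha>" "\<alpha> \<le> 1"
    and L_nonneg: "\<And>t. L t \<ge> 0"
    and \<eta>_1: "\<eta> 1 > 0" and \<tau>_1: "\<tau> 1 = 0" and \<tau>_2: "\<tau> 2 = \<mu>"
    and \<eta>_2: "ereal (\<eta> 2) = min (ereal ((1 - \<beta>) * \<eta> 1)) (equot \<mu> (4 * (L 1)\<^sup>2))"
    and \<eta>_Suc: "\<And>t. t \<ge> 2 \<Longrightarrow> ereal (\<eta> (Suc t)) = min (ereal (4 / 3 * \<eta> t))
        (min (equot (\<tau> (t - 1) + \<mu>) (\<tau> t) * ereal (\<eta> t)) (equot (\<tau> t) (4 * (L t)\<^sup>2)))"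
    and \<tau>_Suc: "\<And>t. t \<ge> 2 \<Longrightarrow> \<tau> (Suc t) =
        \<tau> t + \<mu> / 2 * (\<alpha> + (1 - \<alpha>) * \<eta> (Suc t) * (4 * (L t)\<^sup>2 / \<tau> t))"
begin

lemma \<eta>_2_pos: "\<eta> 2 > 0"
proof -
  have "0 < ereal (\<eta> 2)"
    unfolding \<eta>_2 using \<beta>_less \<eta>_1 \<mu>_pos by (simp add: equot_pos)
  then show ?thesis by simp
qed

lemma le_\<eta>_2_iff: "d > 0 \<Longrightarrow> d \<le> \<eta> 2 \<longleftrightarrow> d \<le> (1 - \<beta>) * \<eta> 1 \<and> d * (4 * (L 1)\<^sup>2) \<le> \<mu>"
proof -
  assume "d > 0"
  then have "ereal d \<le> ereal (\<eta> 2) \<longleftrightarrow> d \<le> (1 - \<beta>) * \<eta> 1 \<and> d * (4 * (L 1)\<^sup>2) \<le> \<mu>"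
    unfolding \<eta>_2 using \<mu>_pos by (simp add: le_equot_iff)
  then show ?thesis by simp
qed

lemma \<eta>_pos_\<tau>_ge: "t \<ge> 2 \<Longrightarrow> \<eta> t > 0 \<and> \<tau> t \<ge> \<mu> \<and> \<tau> (t - 1) \<ge> 0"
proof (induction t rule: nat_induct_at_least)
  case base
  then show ?case
    using \<eta>_2_pos \<tau>_1 \<tau>_2 by simp
next
  case (Suc t)
  then have pos: "\<eta> t > 0" "\<tau> t > 0" "\<tau> (t - 1) + \<mu> > 0"
    using \<mu>_pos by auto
  then have "0 < ereal (\<eta> (Suc t))"
    unfolding \<eta>_Suc[OF Suc.hyps] by (simp add: equot_pos equot_nonzero)
  moreover from this have "\<tau> (Suc t) \<ge> \<tau> t"
    unfolding \<tau>_Suc[OF Suc.hyps] using pos \<mu>_pos \<alpha> by simp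
  ultimately show ?case
    using Suc.IH \<mu>_pos by simp
qed

lemma \<eta>_pos: "t \<ge> 1 \<Longrightarrow> \<eta> t > 0"
  using \<eta>_1 \<eta>_pos_\<tau>_ge[of t] by (cases "t = 1") auto

lemma le_\<eta>_Suc_iff:
  assumes "t \<ge> 2" "d > 0"
  shows "d \<le> \<eta> (Suc t) \<longleftrightarrow>
    d \<le> 4 / 3 * \<eta> t \<and> d * \<tau> t \<le> \<eta> t * (\<tau> (t - 1) + \<mu>) \<and> d * (4 * (L t)\<^sup>2) \<le> \<tau> t"
proof -
  have \<tau>: "\<tau> t > 0"
    using \<eta>_pos_\<tau>_ge[OF assms(1)] \<mu>_pos by simp
  then have "ereal d \<le> ereal (\<eta> (Suc t)) \<longleftrightarrow>
      d \<le> 4 / 3 * \<eta> t \<and> d \<le> (\<tau> (t - 1) + \<mu>) / \<tau> t * \<eta> t \<and> d * (4 * (L t)\<^sup>2) \<le> \<tau> t"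
    unfolding \<eta>_Suc[OF assms(1)] using assms(2) by (simp add: le_equot_iff equot_nonzero)
  then show ?thesis
    using \<tau> by (simp add: pos_le_divide_eq mult.commute)
qed

lemma \<eta>_Suc_le:
  assumes "t \<ge> 2"
  shows "\<eta> (Suc t) \<le> 4 / 3 * \<eta> t"
    and "\<eta> (Suc t) * \<tau> t \<le> \<eta> t * (\<tau> (t - 1) + \<mu>)"
    and "\<eta> (Suc t) * (4 * (L t)\<^sup>2) \<le> \<tau> t"
  using le_\<eta>_Suc_iff[OF assms, of "\<eta> (Suc t)"] \<eta>_pos[of "Suc t"] by auto

text \<open>
  The local restriction on \<open>\<eta> (t + 1)\<close> makes the bracket in the rule for \<open>\<tau>\<close> a convex combination of
  \<open>1\<close> and a number in the unit interval, with weight \<open>\<alpha>\<close> on \<open>1\<close>.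
\<close>

lemma \<tau>_Suc_bounds:
  assumes t: "t \<ge> 2"
  shows "\<tau> t + \<alpha> * \<mu> / 2 \<le> \<tau> (Suc t)" "\<tau> (Suc t) \<le> \<tau> t + \<mu> / 2"
proof -
  define s where "s = \<eta> (Suc t) * (4 * (L t)\<^sup>2 / \<tau> t)"
  have \<tau>: "\<tau> t > 0"
    using \<eta>_pos_\<tau>_ge[OF t] \<mu>_pos by simp
  have s: "0 \<le> s" "s \<le> 1"
    using \<eta>_Suc_le(3)[OF t] \<eta>_pos[of "Suc t"] \<tau> by (simp_all add: s_def field_simps)
  have eq: "\<tau> (Suc t) = \<tau> t + \<mu> / 2 * (\<alpha> + (1 - \<alpha>) * s)"
    using \<tau>_Suc[OF t] by (simp add: s_def mult.assoc)
  have "0 \<le> (1 - \<alpha>) * s" "(1 - \<alpha>) * s \<le> 1 - \<alpha>"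
    using s \<alpha> by (auto intro: mult_left_le)
  then have "\<mu> / 2 * \<alpha> \<le> \<mu> / 2 * (\<alpha> + (1 - \<alpha>) * s)" "\<mu> / 2 * (\<alpha> + (1 - \<alpha>) * s) \<le> \<mu> / 2 * 1"
    using \<mu>_pos by (auto intro!: mult_left_mono simp del: mult_le_cancel_left)
  then show "\<tau> t + \<alpha> * \<mu> / 2 \<le> \<tau> (Suc t)" "\<tau> (Suc t) \<le> \<tau> t + \<mu> / 2"
    unfolding eq by (simp_all add: mult.commute)
qed

lemma \<tau>_bounds:
  assumes "t \<ge> 2"
  shows "\<mu> * (1 + \<alpha> * (real t - 2) / 2) \<le> \<tau> t \<and> \<tau> t \<le> \<mu> * real t / 2"
  using assms
proof (induction t rule: nat_induct_at_least)
  case base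
  then show ?case using \<tau>_2 by simp
next
  case (Suc t)
  then show ?case
    using \<tau>_Suc_bounds[of t] by (simp add: field_simps)
qed

lemma \<eta>_2_lower_bound:
  assumes "M > 0" "\<mu> \<le> 4 * (1 - \<beta>) * \<eta> 1 * M\<^sup>2" "L 1 \<le> M"
  shows "\<mu> / (4 * M\<^sup>2) \<le> \<eta> 2"
proof -
  have "(L 1)\<^sup>2 \<le> M\<^sup>2"
    using assms L_nonneg by (intro power_mono) auto
  then show ?thesis
    using assms \<mu>_pos by (subst le_\<eta>_2_iff) (auto simp: field_simps)
qed

text \<open>
  Each of the three entries of the minimum admits the linear lower bound.  The entry with \<open>\<tau>\<close> allows
  growth by \<open>T + 1\<close> over \<open>T\<close> in passing from \<open>T\<close> to \<open>T + 1\<close>, because \<open>\<tau>\<close> increases by at most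
  \<open>\<mu> / 2\<close> per step and is at most linear; for \<open>T \<ge> 3\<close> this is at most \<open>4 / 3\<close>.  The slope
  \<open>\<alpha> / 3\<close>, rather than the slope \<open>\<alpha> / 2\<close> of the lower bound for \<open>\<tau>\<close>, is what such growth sustains
  from equal values at \<open>2\<close> and \<open>3\<close>.
\<close>

lemma \<eta>_lower_bound:
  assumes "t \<ge> 3" and M: "M > 0" "\<mu> \<le> 4 * (1 - \<beta>) * \<eta> 1 * M\<^sup>2"
    and L: "\<And>j. 1 \<le> j \<Longrightarrow> j < t \<Longrightarrow> L j \<le> M"
  shows "\<mu> * (1 + \<alpha> * (real t - 3) / 3) / (4 * M\<^sup>2) \<le> \<eta> t"
  using assms(1) L
proof (induction t rule: nat_induct_at_least)
  case base
  define d where "d = \<mu> / (4 * M\<^sup>2)"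
  have d: "d > 0" "d * (4 * M\<^sup>2) = \<mu>"
    using M \<mu>_pos by (simp_all add: d_def)
  have le: "d \<le> \<eta> 2"
    unfolding d_def using base M by (intro \<eta>_2_lower_bound) auto
  have "(L 2)\<^sup>2 \<le> M\<^sup>2"
    using base L_nonneg by (intro power_mono) auto
  then have "d * (4 * (L 2)\<^sup>2) \<le> d * (4 * M\<^sup>2)"
    using d by (intro mult_left_mono) auto
  moreover have "d * \<mu> \<le> \<eta> 2 * \<mu>"
    using le \<mu>_pos by simp
  ultimately have "d \<le> \<eta> (Suc 2)"
    using le d \<eta>_2_pos \<tau>_1 \<tau>_2 by (subst le_\<eta>_Suc_iff) auto
  then show ?case
    by (simp add: d_def eval_nat_numeral)
next
  case (Suc t)
  define g where "g = (\<lambda>t. \<mu> * (1 + \<alpha> * (t - 3) / 3))"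
  define d where "d = g (real (Suc t)) / (4 * M\<^sup>2)"
  define T where "T = real t"
  have T: "T \<ge> 3" "real (Suc t) = T + 1"
    using Suc.hyps by (auto simp: T_def)
  have t2: "t \<ge> 2"
    using Suc.hyps by simp
  have IH: "g T / (4 * M\<^sup>2) \<le> \<eta> t"
    using Suc by (simp add: g_def T_def)
  have "g (T + 1) > 0"
    unfolding g_def using T \<mu>_pos \<alpha> by (intro mult_pos_pos add_pos_nonneg) auto
  then have d: "d > 0" "d * (4 * M\<^sup>2) = g (T + 1)"
    using M(1) by (simp_all add: d_def T(2) del: of_nat_Suc)
  have "T * g (T + 1) \<le> (T + 1) * g T"
  proof -
    have "(T + 1) * g T - T * g (T + 1) = \<mu> * (1 - \<alpha>)"
      by (simp add: g_def field_simps)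
    then show ?thesis
      using \<mu>_pos \<alpha> by (smt (verit) mult_nonneg_nonneg)
  qed
  then have "T * d \<le> (T + 1) * (g T / (4 * M\<^sup>2))"
    using divide_right_mono[of "T * g (T + 1)" "(T + 1) * g T" "4 * M\<^sup>2"]
    by (simp add: d_def T(2) del: of_nat_Suc)
  also have "\<dots> \<le> (T + 1) * \<eta> t"
    using IH T by (intro mult_left_mono) auto
  finally have growth: "T * d \<le> (T + 1) * \<eta> t" .
  have \<eta>t: "\<eta> t > 0"
    using \<eta>_pos t2 by simp
  have 1: "d \<le> 4 / 3 * \<eta> t"
  proof -
    have "(T + 1) * \<eta> t = T * \<eta> t + \<eta> t"
      by (simp add: distrib_right)
    then have "T * d \<le> 4 / 3 * (T * \<eta> t)"
      using growth mult_right_mono[OF T(1), of "\<eta> t"] \<eta>t by linarith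
    then have "T * d \<le> T * (4 / 3 * \<eta> t)"
      by (simp only: mult.left_commute)
    then show ?thesis using T by simp
  qed
  have 2: "d * \<tau> t \<le> \<eta> t * (\<tau> (t - 1) + \<mu>)"
  proof -
    obtain s where s: "t = Suc s" "s \<ge> 2"
      using Suc.hyps by (cases t) auto
    have "(T + 1) * \<tau> t \<le> (T + 1) * (\<tau> s + \<mu> / 2)"
      using \<tau>_Suc_bounds(2)[of s] s T by (intro mult_left_mono) auto
    also have "\<dots> \<le> T * (\<tau> s + \<mu>)"
      using \<tau>_bounds[of s] s by (simp add: T_def algebra_simps)
    finally have *: "(T + 1) * \<tau> t \<le> T * (\<tau> (t - 1) + \<mu>)"
      using s by simp
    have "T * (d * \<tau> t) \<le> (T + 1) * \<eta> t * \<tau> t"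
      using mult_right_mono[OF growth, of "\<tau> t"] \<eta>_pos_\<tau>_ge[OF t2] \<mu>_pos by (simp add: mult_ac)
    also have "\<dots> \<le> T * (\<eta> t * (\<tau> (t - 1) + \<mu>))"
      using mult_left_mono[OF *, of "\<eta> t"] \<eta>t by (simp add: mult_ac)
    finally show ?thesis using T by simp
  qed
  have 3: "d * (4 * (L t)\<^sup>2) \<le> \<tau> t"
  proof -
    have "(L t)\<^sup>2 \<le> M\<^sup>2"
      using Suc.prems[of t] t2 L_nonneg by (intro power_mono) auto
    then have "d * (4 * (L t)\<^sup>2) \<le> d * (4 * M\<^sup>2)"
      using d by (intro mult_left_mono) auto
    also have "\<dots> \<le> \<mu> * (1 + \<alpha> * (T - 2) / 2)"
      unfolding d g_def using \<mu>_pos \<alpha> T by (intro mult_left_mono) (auto simp: field_simps)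
    also have "\<dots> \<le> \<tau> t"
      using \<tau>_bounds[OF t2] by (simp add: T_def)
    finally show ?thesis .
  qed
  have "d \<le> \<eta> (Suc t)"
    using 1 2 3 d t2 by (subst le_\<eta>_Suc_iff) auto
  then show ?case
    unfolding d_def g_def .
qed

text \<open>
  Taken at index \<open>2\<close>, the linear function is below \<open>\<mu> / (4 M\<^sup>2)\<close>, so it bounds all summands.
\<close>

lemma \<eta>_sum_lower_bound:
  assumes k: "k \<ge> 1" and M: "M > 0" "\<mu> \<le> 4 * (1 - \<beta>) * \<eta> 1 * M\<^sup>2"
    and L: "\<And>j. 1 \<le> j \<Longrightarrow> j \<le> k \<Longrightarrow> L j \<le> M"
  shows "\<mu> * (6 * real k + \<alpha> * real k * (real k - 3)) / (24 * M\<^sup>2) \<le> (\<Sum>t=1..k. \<eta> (t + 1))"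
proof -
  have "\<mu> * (1 + \<alpha> * (real t - 2) / 3) / (4 * M\<^sup>2) \<le> \<eta> (t + 1)" if t: "t \<in> {1..k}" for t
  proof (cases "t = 1")
    case True
    have "\<mu> * (1 + \<alpha> * (real t - 2) / 3) / (4 * M\<^sup>2) \<le> \<mu> * 1 / (4 * M\<^sup>2)"
      using True \<mu>_pos \<alpha> by (intro divide_right_mono mult_left_mono) auto
    then show ?thesis
      using \<eta>_2_lower_bound[OF M] L[of 1] k True by (simp add: numeral_2_eq_2)
  next
    case False
    then show ?thesis
      using \<eta>_lower_bound[of "t + 1" M] M L t by (simp add: diff_diff_eq)
  qed
  then have "(\<Sum>t=1..k. \<mu> * (1 + \<alpha> * (real t - 2) / 3) / (4 * M\<^sup>2)) \<le> (\<Sum>t=1..k. \<eta> (t + 1))"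
    by (rule sum_mono)
  moreover have "(\<Sum>t=1..k. \<mu> * (1 + \<alpha> * (real t - 2) / 3) / (4 * M\<^sup>2))
      = \<mu> * (6 * real k + \<alpha> * real k * (real k - 3)) / (24 * M\<^sup>2)"
  proof -
    have "(\<Sum>t=1..k. 1 + \<alpha> * (real t - 2) / 3) = (6 * real k + \<alpha> * real k * (real k - 3)) / 6"
      by (induction k) (simp_all add: field_simps)
    moreover have "(\<Sum>t=1..k. \<mu> * (1 + \<alpha> * (real t - 2) / 3) / (4 * M\<^sup>2))
        = \<mu> * (\<Sum>t=1..k. 1 + \<alpha> * (real t - 2) / 3) / (4 * M\<^sup>2)"
      by (simp only: sum_distrib_left sum_divide_distrib)
    ultimately show ?thesis
      by (simp only:)
  qed
  ultimately show ?thesis by simp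
qed

end

section \<open>Convergence bounds\<close>

lemma max_local_norm_ge:
  assumes "0 < \<mu>" "\<beta> < 1" "0 < \<eta>1"
  shows "max_local_norm A y \<mu> \<beta> \<eta>1 k > 0"
    and "\<mu> \<le> 4 * (1 - \<beta>) * \<eta>1 * (max_local_norm A y \<mu> \<beta> \<eta>1 k)\<^sup>2"
    and "1 \<le> j \<Longrightarrow> j \<le> k \<Longrightarrow> local_norm A y j \<le> max_local_norm A y \<mu> \<beta> \<eta>1 k"
proof -
  let ?M = "max_local_norm A y \<mu> \<beta> \<eta>1 k" and ?s = "sqrt (\<mu> / (4 * (1 - \<beta>) * \<eta>1))"
  have le: "?s \<le> ?M"
    unfolding max_local_norm_def by (intro Max_ge) auto
  have s: "?s > 0"
    using assms by simp
  then show "?M > 0"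
    using le by linarith
  have "?s\<^sup>2 \<le> ?M\<^sup>2"
    using le s by (intro power_mono) auto
  then have "\<mu> / (4 * (1 - \<beta>) * \<eta>1) \<le> ?M\<^sup>2"
    using assms by simp
  then show "\<mu> \<le> 4 * (1 - \<beta>) * \<eta>1 * ?M\<^sup>2"
    using assms by (simp add: pos_divide_le_eq mult.commute)
  show "1 \<le> j \<Longrightarrow> j \<le> k \<Longrightarrow> local_norm A y j \<le> ?M"
    unfolding max_local_norm_def by (intro Max_ge) auto
qed

theorem proposition2p5:
  fixes X :: "(real^'n) set" and f :: "real^'n \<Rightarrow> real"
    and A :: "real^'n^'m" and b :: "real^'m"
    and xs :: "real^'n" and ys :: "real^'m"
    and x xbar :: "nat \<Rightarrow> real^'n" and y :: "nat \<Rightarrow> real^'m"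
    and \<mu> \<beta> :: real and \<beta>t \<eta> \<tau> :: "nat \<Rightarrow> real"
  assumes "X \<noteq> {}" and "closed X" and "convex X"
    and "convex_on X f" and "lsc_on X f"
    and "is_arg_min f (\<lambda>u. u \<in> X \<and> A *v u = b) xs"
    and "saddle_point X f A b xs ys"
    and "\<mu> > 0"
    and "ac_pdhg X f A b \<mu> \<beta>t \<eta> \<tau> x xbar y"
  shows
    "(\<beta> \<in> {0<..<1} \<and> (\<forall>t\<ge>1. \<eta> t > 0) \<and> (\<forall>t\<ge>1. \<tau> t \<ge> 0) \<and>
      \<tau> 1 = 0 \<and> \<beta>t 1 = 0 \<and> (\<forall>t\<ge>2. \<beta>t t = \<beta>) \<and>
      ereal (\<eta> 2) \<le> min (ereal ((1 - \<beta>) * \<eta> 1)) (equot \<mu> (4 * (local_norm A y 1)\<^sup>2)) \<and>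
      (\<forall>t\<ge>3. ereal (\<eta> t) \<le>
         min (ereal (2 * (1 - \<beta>)\<^sup>2 * \<eta> (t - 1)))
        (min (equot (\<tau> (t - 2) + \<mu>) (\<tau> (t - 1)) * ereal (\<eta> (t - 1)))
             (equot (\<tau> (t - 1)) (4 * (local_norm A y (t - 1))\<^sup>2))))
      \<longrightarrow>
      (\<forall>k\<ge>2.
         f (ergodic_avg \<eta> x k) - f xs
           \<le> 1 / (\<Sum>t=1..k. \<eta> (t + 1)) *
              ((norm (x 0 - xs))\<^sup>2 / (2 * \<beta>)
               + (5 * \<eta> 2 * (local_norm A y 1)\<^sup>2 / (4 * \<mu>) - \<eta> 2 / (2 * \<eta> 1))
                 * (norm (x 1 - x 0))\<^sup>2) \<and>
         norm (A *v ergodic_avg \<eta> x k - b)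
           \<le> 2 * \<mu> * norm ys + 2 * sqrt (\<mu> / (\<Sum>t=1..k. \<eta> (t + 1)) *
              max 0 ((norm (x 0 - xs))\<^sup>2 / (2 * \<beta>)
               + (5 * \<eta> 2 * (local_norm A y 1)\<^sup>2 / (4 * \<mu>) - \<eta> 2 / (2 * \<eta> 1))
                 * (norm (x 1 - x 0))\<^sup>2))))
   \<and>
     (\<forall>\<alpha>.
      \<alpha> \<in> {0<..1} \<and> \<beta> \<in> {0<..1 - sqrt 6 / 3} \<and> \<eta> 1 > 0 \<and>
      \<beta>t 1 = 0 \<and> (\<forall>t\<ge>2. \<beta>t t = \<beta>) \<and> \<tau> 1 = 0 \<and> \<tau> 2 = \<mu> \<and>
      ereal (\<eta> 2) = min (ereal ((1 - \<beta>) * \<eta> 1)) (equot \<mu> (4 * (local_norm A y 1)\<^sup>2)) \<and>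
      (\<forall>t\<ge>3. ereal (\<eta> t) =
         min (ereal (4 / 3 * \<eta> (t - 1)))
        (min (equot (\<tau> (t - 2) + \<mu>) (\<tau> (t - 1)) * ereal (\<eta> (t - 1)))
             (equot (\<tau> (t - 1)) (4 * (local_norm A y (t - 1))\<^sup>2)))) \<and>
      (\<forall>t\<ge>3. \<tau> t = \<tau> (t - 1) + \<mu> / 2 *
         (\<alpha> + (1 - \<alpha>) * \<eta> t * (4 * (local_norm A y (t - 1))\<^sup>2 / \<tau> (t - 1))))
      \<longrightarrow>
      (\<forall>k\<ge>2.
         f (ergodic_avg \<eta> x k) - f xs
           \<le> 12 * (max_local_norm A y \<mu> \<beta> (\<eta> 1) k)\<^sup>2
                / (\<mu> * (6 * real k + \<alpha> * real k * (real k - 3))) *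
              max 0 ((norm (x 0 - xs))\<^sup>2 / \<beta>
               + (5 * \<eta> 2 * (local_norm A y 1)\<^sup>2 / (2 * \<mu>) - \<eta> 2 / (2 * \<eta> 1))
                 * (norm (x 1 - x 0))\<^sup>2) \<and>
         norm (A *v ergodic_avg \<eta> x k - b)
           \<le> 2 * \<mu> * norm ys + 2 * sqrt (12 * (max_local_norm A y \<mu> \<beta> (\<eta> 1) k)\<^sup>2
                / (6 * real k + \<alpha> * real k * (real k - 3)) *
              max 0 ((norm (x 0 - xs))\<^sup>2 / \<beta>
               + (5 * \<eta> 2 * (local_norm A y 1)\<^sup>2 / (2 * \<mu>) - \<eta> 2 / (2 * \<eta> 1))
                 * (norm (x 1 - x 0))\<^sup>2))))"

proof ((rule conjI; intro allI impI), goal_cases)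
  case (1 k)
  note H = 1(1)
  have \<beta>: "0 < \<beta>" "\<beta> < 1" and \<eta>: "\<And>t. t \<ge> 1 \<Longrightarrow> \<eta> t > 0" and \<tau>: "\<And>t. t \<ge> 1 \<Longrightarrow> \<tau> t \<ge> 0"
    and H3: "\<And>t. t \<ge> 3 \<Longrightarrow> ereal (\<eta> t) \<le>
         min (ereal (2 * (1 - \<beta>)\<^sup>2 * \<eta> (t - 1)))
        (min (equot (\<tau> (t - 2) + \<mu>) (\<tau> (t - 1)) * ereal (\<eta> (t - 1)))
             (equot (\<tau> (t - 1)) (4 * (local_norm A y (t - 1))\<^sup>2)))"
    using H by auto
  have local: "\<tau> t > 0 \<and> \<eta> (Suc t) * (4 * (local_norm A y t)\<^sup>2) \<le> \<tau> t" if "t \<ge> 2" for t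
    using H3[of "Suc t"] \<eta>[of "Suc t"] \<tau>[of t] that by (simp add: le_equot_iff)
  have dual: "\<eta> (Suc t) * \<tau> t \<le> \<eta> t * (\<tau> (t - 1) + \<mu>)" if "t \<ge> 2" for t
    using H3[of "Suc t"] local[OF that] that
    by (simp add: equot_nonzero pos_le_divide_eq mult.commute)
  interpret ac_pdhg_admissible X f A b xs x xbar y \<mu> \<beta> \<beta>t \<eta> \<tau>
  proof
    show "\<eta> 2 \<le> (1 - \<beta>) * \<eta> 1" "\<eta> 2 * (4 * (local_norm A y 1)\<^sup>2) \<le> \<mu>"
      using H \<eta>[of 2] assms(8) by (auto simp: le_equot_iff)
    show "\<eta> (Suc t) \<le> 2 * (1 - \<beta>)\<^sup>2 * \<eta> t" if "t \<ge> 2" for t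
      using H3[of "Suc t"] that by simp
  qed (use assms \<beta> \<eta> local dual H in \<open>auto simp: is_arg_min_def\<close>)
  have k: "k \<ge> 1" using 1(2) by simp
  define S where "S = (\<Sum>t=1..k. \<eta> (t + 1))"
  define C where "C = max 0 error_const"
  have S: "S > 0"
    unfolding S_def using weight_sum_pos[OF k] .
  have C: "error_const / S \<le> C / S" "0 \<le> C / S"
    using S by (auto simp: C_def intro!: divide_right_mono)
  have "sqrt (2 * \<mu> * (C / S)) \<le> sqrt (2\<^sup>2 * (\<mu> / S * C))"
    using C(2) assms(8) S by (simp add: C_def field_simps)
  also have "\<dots> = 2 * sqrt (\<mu> / S * C)"
    by (simp only: real_sqrt_mult real_sqrt_abs)
  finally have "norm (A *v ergodic_avg \<eta> x k - b) \<le> 2 * \<mu> * norm ys + 2 * sqrt (\<mu> / S * C)"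
    using infeasibility_bound[OF k assms(7), of "C / S"] C unfolding S_def by linarith
  then show ?case
    using objective_bound[OF k] unfolding S_def C_def error_const_def by simp
next
  case (2 \<alpha> k)
  note H = 2(1)
  have "sqrt 6 / 3 > 0" "0 < \<beta>" "\<beta> \<le> 1 - sqrt 6 / 3"
    using H by simp_all
  then have \<beta>: "0 < \<beta>" "\<beta> < 1" "sqrt 6 / 3 \<le> 1 - \<beta>"
    by linarith+
  \<comment> \<open>The bound on \<open>\<beta>\<close> is exactly what makes growth by \<open>4 / 3\<close> admissible.\<close>
  have "(sqrt 6 / 3)\<^sup>2 \<le> (1 - \<beta>)\<^sup>2"
    using \<beta>(3) by (intro power_mono) auto
  then have \<beta>_sq: "4 / 3 \<le> 2 * (1 - \<beta>)\<^sup>2"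
    by (simp add: power_divide)
  interpret adaptive_steps "local_norm A y" \<eta> \<tau> \<mu> \<beta> \<alpha>
  proof
    fix t :: nat assume t: "t \<ge> 2"
    have H3: "\<forall>t\<ge>3. ereal (\<eta> t) =
         min (ereal (4 / 3 * \<eta> (t - 1)))
        (min (equot (\<tau> (t - 2) + \<mu>) (\<tau> (t - 1)) * ereal (\<eta> (t - 1)))
             (equot (\<tau> (t - 1)) (4 * (local_norm A y (t - 1))\<^sup>2)))"
      and H4: "\<forall>t\<ge>3. \<tau> t = \<tau> (t - 1) + \<mu> / 2 *
         (\<alpha> + (1 - \<alpha>) * \<eta> t * (4 * (local_norm A y (t - 1))\<^sup>2 / \<tau> (t - 1)))"
      using H by blast+
    show "ereal (\<eta> (Suc t)) = min (ereal (4 / 3 * \<eta> t))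
        (min (equot (\<tau> (t - 1) + \<mu>) (\<tau> t) * ereal (\<eta> t))
          (equot (\<tau> t) (4 * (local_norm A y t)\<^sup>2)))"
      using H3[rule_format, of "Suc t"] t by (simp add: numeral_2_eq_2)
    show "\<tau> (Suc t) = \<tau> t + \<mu> / 2 *
        (\<alpha> + (1 - \<alpha>) * \<eta> (Suc t) * (4 * (local_norm A y t)\<^sup>2 / \<tau> t))"
      using H4[rule_format, of "Suc t"] t by simp
  qed (use assms \<beta> H in \<open>auto simp: local_norm_def\<close>)
  interpret ac_pdhg_admissible X f A b xs x xbar y \<mu> \<beta> \<beta>t \<eta> \<tau>
  proof
    show "\<eta> 2 \<le> (1 - \<beta>) * \<eta> 1" "\<eta> 2 * (4 * (local_norm A y 1)\<^sup>2) \<le> \<mu>"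
      using le_\<eta>_2_iff[OF \<eta>_2_pos] by auto
    fix t :: nat assume t: "t \<ge> 2"
    show "\<eta> (Suc t) \<le> 2 * (1 - \<beta>)\<^sup>2 * \<eta> t"
      using \<eta>_Suc_le(1)[OF t] mult_right_mono[OF \<beta>_sq, of "\<eta> t"] \<eta>_pos[of t] t by linarith
    show "\<tau> t > 0"
      using \<eta>_pos_\<tau>_ge[OF t] assms(8) by simp
  qed (use assms \<beta> H \<eta>_pos \<eta>_Suc_le in \<open>auto simp: is_arg_min_def\<close>)
  have k: "k \<ge> 1" using 2(2) by simp
  define S where "S = (\<Sum>t=1..k. \<eta> (t + 1))"
  define M where "M = max_local_norm A y \<mu> \<beta> (\<eta> 1) k"
  define D where "D = 6 * real k + \<alpha> * real k * (real k - 3)"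
  define B where "B = (norm (x 0 - xs))\<^sup>2 / \<beta>
      + (5 * \<eta> 2 * (local_norm A y 1)\<^sup>2 / (2 * \<mu>) - \<eta> 2 / (2 * \<eta> 1)) * (norm (x 1 - x 0))\<^sup>2"
  define C where "C = max 0 B"
  define e where "e = 12 * M\<^sup>2 / (\<mu> * D) * C"
  have S: "S > 0"
    unfolding S_def using weight_sum_pos[OF k] .
  have "\<alpha> * (3 - real k) \<le> \<alpha> * 1"
    using \<alpha> 2(2) by (intro mult_left_mono) auto
  then have "\<alpha> * (3 - real k) < 6"
    using \<alpha> by linarith
  then have "real k * (6 + \<alpha> * (real k - 3)) > 0"
    using k by (intro mult_pos_pos) (auto simp: algebra_simps)
  then have D: "D > 0"
    by (simp add: D_def algebra_simps)
  have M: "M > 0" "\<mu> \<le> 4 * (1 - \<beta>) * \<eta> 1 * M\<^sup>2" "\<And>j. 1 \<le> j \<Longrightarrow> j \<le> k \<Longrightarrow> local_norm A y j \<le> M"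
    unfolding M_def by (fact max_local_norm_ge[OF assms(8) \<beta>(2) \<eta>_1])+
  have "\<mu> * D / (24 * M\<^sup>2) \<le> S"
    unfolding S_def D_def using k M by (rule \<eta>_sum_lower_bound)
  then have SK: "1 / (2 * S) \<le> 12 * M\<^sup>2 / (\<mu> * D)"
    using S D M(1) assms(8) by (simp add: field_simps)
  \<comment> \<open>Doubling \<open>error_const\<close> doubles also its negative term; the stated bracket keeps that term once.\<close>
  have "error_const \<le> C / 2"
  proof -
    have "0 \<le> \<eta> 2 / (2 * \<eta> 1) * (norm (x 1 - x 0))\<^sup>2"
      using \<eta>_pos[of 1] \<eta>_pos[of 2] by simp
    moreover have "2 * error_const = B - \<eta> 2 / (2 * \<eta> 1) * (norm (x 1 - x 0))\<^sup>2"
      by (simp add: error_const_def B_def algebra_simps)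
    moreover have "B \<le> C"
      by (simp add: C_def)
    ultimately show ?thesis
      by linarith
  qed
  then have "error_const / S \<le> C / 2 / S"
    using S by (intro divide_right_mono) auto
  also have "\<dots> = 1 / (2 * S) * C"
    by simp
  also have "\<dots> \<le> e"
    unfolding e_def by (intro mult_right_mono SK) (simp add: C_def)
  finally have e: "error_const / S \<le> e" .
  have e0: "0 \<le> e"
    using D assms(8) by (simp add: e_def C_def)
  have "sqrt (2 * \<mu> * e) \<le> sqrt (2\<^sup>2 * (\<mu> * e))"
    using e0 assms(8) by simp
  also have "\<dots> = 2 * sqrt (\<mu> * e)"
    by (simp only: real_sqrt_mult real_sqrt_abs)
  also have "\<mu> * e = 12 * M\<^sup>2 / D * C"
    using assms(8) by (simp add: e_def)
  finally have "norm (A *v ergodic_avg \<eta> x k - b) \<le> 2 * \<mu> * norm ys + 2 * sqrt (12 * M\<^sup>2 / D * C)"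
    using infeasibility_bound[OF k assms(7), of e] e e0 unfolding S_def by linarith
  moreover have "f (ergodic_avg \<eta> x k) - f xs \<le> e"
    using objective_bound[OF k] e unfolding S_def by linarith
  ultimately show ?case
    unfolding e_def M_def D_def C_def B_def by blast
qed

end
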